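(* For integers $n\geq 0$ let $P_n(x)=2^{-2n}\sum_{j=0}^{n} 2^j\binom{2n-2j}{n-j}\binom{n+j}{j}(x+1)^j$, write $P_n(x)=\sum_{i=0}^n d_i(n)x^i$, and define $Q_n(x)=\sum_{i=0}^n \frac{d_i(n)}{i!}x^i$. Then $\{Q_n(x)\}_{n\geq 0}$ is a Sturm sequence. In particular, $Q_n(x)$ has only real zeros for every $n\geq 1$.
   Context: A real polynomial is standard if it is zero or has positive leading coefficient. $\mathrm{RZ}$ denotes the set of real polynomials with only real zeros. If $f\in\mathrm{RZ}$ has degree $n$ with zeros $r_n\le\cdots\le r_1$ and $g\in\mathrm{RZ}$ has degree $m$ with zeros $s_m\le\cdots\le s_1$, then $g$ interlaces $f$ if $n=m+1$ and $r_n\le s_{n-1}\le r_{n-1}\le\cdots\le r_2\le s_1\le r_1$; $g$ strictly interlaces $f$ (written $g\prec f$) if in addition $f$ and $g$ have no common zeros. By convention, for any real numbers $a,b,c$, the constant $a$ is in $\mathrm{RZ}$ and $a\prec bx+c$. A sequence $\{f_n(x)\}_{n\ge 0}$ of standard polynomials is a Sturm sequence if for all $n\ge 0$: $\deg f_n=n$, $f_n\in\mathrm{RZ}$, and $f_n\prec f_{n+1}$. *)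

theory Defs
  imports "HOL-Computational_Algebra.Computational_Algebra" Complex_Main
begin

definition standard_poly :: "real poly \<Rightarrow> bool" where
  "standard_poly f \<longleftrightarrow> f = 0 \<or> lead_coeff f > 0"

text \<open>The zero polynomial is included: every real constant belongs to RZ by convention.\<close>

definition RZ :: "real poly set" where
  "RZ = {f. f = 0 \<or> (\<forall>z::complex. poly (map_poly complex_of_real f) z = 0 \<longrightarrow> z \<in> \<real>)}"

text \<open>The real zeros, with multiplicity and in decreasing order, so that the zero called
  \<open>r\<^sub>1\<close> (the largest) has index 0. For a nonzero \<open>f \<in> RZ\<close> this list has length \<open>degree f\<close>.\<close>

definition zeros :: "real poly \<Rightarrow> real list" where
  "zeros f = rev (sorted_list_of_multiset (proots f))"

definition interlaces :: "real poly \<Rightarrow> real poly \<Rightarrow> bool" where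
  "interlaces g f \<longleftrightarrow>
     f \<in> RZ \<and> g \<in> RZ \<and> f \<noteq> 0 \<and> g \<noteq> 0 \<and> degree f = degree g + 1 \<and>
     (\<forall>i<degree g. zeros f ! (i + 1) \<le> zeros g ! i \<and> zeros g ! i \<le> zeros f ! i)"

text \<open>The first disjunct is the convention \<open>a \<prec> b x + c\<close> for arbitrary real numbers
  \<open>a\<close>, \<open>b\<close>, \<open>c\<close>. Since all zeros are real, it suffices to exclude real common zeros.\<close>

definition strictly_interlaces :: "real poly \<Rightarrow> real poly \<Rightarrow> bool"  (infix "\<prec>" 50) where
  "g \<prec> f \<longleftrightarrow>
     (\<exists>a b c. g = [:a:] \<and> f = [:c, b:]) \<or>
     (interlaces g f \<and> \<not> (\<exists>x. poly f x = 0 \<and> poly g x = 0))"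

text \<open>The condition \<open>f n \<noteq> 0\<close> matters only for \<open>n = 0\<close>: in the library the zero polynomial
  has degree 0, whereas a polynomial of degree 0 is meant to be a nonzero constant.\<close>

definition Sturm_sequence :: "(nat \<Rightarrow> real poly) \<Rightarrow> bool" where
  "Sturm_sequence f \<longleftrightarrow>
     (\<forall>n. standard_poly (f n) \<and> f n \<noteq> 0 \<and> degree (f n) = n \<and> f n \<in> RZ \<and> f n \<prec> f (Suc n))"

text \<open>The Boros--Moll polynomials, their coefficients, and the associated polynomials with the
  \<open>i\<close>-th coefficient divided by \<open>i!\<close>.\<close>

definition BM_P :: "nat \<Rightarrow> real poly" where
  "BM_P n = smult (1 / 2 ^ (2 * n))
     (\<Sum>j=0..n. smult (2 ^ j * real ((2 * n - 2 * j) choose (n - j)) * real ((n + j) choose j))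
                  ([:1, 1:] ^ j))"

definition BM_coeff :: "nat \<Rightarrow> nat \<Rightarrow> real" where
  "BM_coeff i n = coeff (BM_P n) i"

definition BM_Q :: "nat \<Rightarrow> real poly" where
  "BM_Q n = (\<Sum>i=0..n. monom (BM_coeff i n / fact i) i)"

end

theory Submission
  imports Defs
begin

text \<open>
  For \<open>m \<ge> 1\<close> the polynomials satisfy the recurrence
  \<open>4(m+1)\<^sup>2 Q\<^bsub>m+1\<^esub> = (16m\<^sup>2+16m+6 + 4(2m+1)x) Q\<^bsub>m\<^esub> + 4x Q'\<^bsub>m\<^esub> - (16m\<^sup>2-1) Q\<^bsub>m-1\<^esub>\<close>.
  It is the image of a recurrence for \<open>P\<^bsub>m\<^esub>\<close> under the Borel transform, which turns \<open>x P'\<close> into \<open>x Q'\<close>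
  and \<open>x (x P)'\<close> into \<open>x Q\<close>; the recurrence for \<open>P\<^bsub>m\<^esub>\<close> can be checked termwise in powers of \<open>x + 1\<close>,
  because there the coefficients are hypergeometric. All coefficients of \<open>Q\<^bsub>m\<^esub>\<close> are positive, so its
  zeros are negative. At such a zero the values of \<open>Q'\<^bsub>m\<^esub>\<close> and (by induction) \<open>Q\<^bsub>m-1\<^esub>\<close> have the same sign,
  and \<open>Q\<^bsub>m+1\<^esub>\<close> has the opposite one. Thus \<open>Q\<^bsub>m+1\<^esub>\<close> alternates in sign along the zeros of \<open>Q\<^bsub>m\<^esub>\<close>,
  and the intermediate value theorem yields interlacing zeros.
\<close>

section \<open>Real-rooted polynomials\<close>

lemma poly_map_poly_of_real:
  "poly (map_poly complex_of_real f) (of_real x) = of_real (poly f x)"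
  by (induction f) (simp_all add: map_poly_pCons)

lemma map_poly_of_real_mult:
  "map_poly complex_of_real (p * q) = map_poly complex_of_real p * map_poly complex_of_real q"
  by (intro poly_eqI) (simp add: coeff_map_poly coeff_mult)

lemma linear_factorE:
  fixes f :: "'a :: idom poly"
  assumes "poly f x = 0" "f \<noteq> 0"
  obtains g where "f = [:- x, 1:] * g" "g \<noteq> 0"
  using assms by (metis dvdE mult_zero_right poly_eq_0_iff_dvd)

lemma proots_linear_mult: "g \<noteq> 0 \<Longrightarrow> proots ([:- x, 1:] * g) = add_mset x (proots g)"
  by (subst proots_mult) auto

lemma degree_linear_mult: "g \<noteq> 0 \<Longrightarrow> degree ([:- x, 1:] * g) = Suc (degree g)"
  for x :: "'a :: idom"
  by (subst degree_mult_eq) auto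

lemma linear_mult_in_RZ_iff: "[:- x, 1:] * g \<in> RZ \<longleftrightarrow> g \<in> RZ"
  by (auto simp: RZ_def map_poly_of_real_mult map_poly_pCons simp del: mult_pCons_left)

lemma RZ_induct [consumes 1, case_names const linear_mult]:
  assumes "f \<in> RZ"
    and const: "\<And>c. P [:c:]"
    and linear_mult: "\<And>x g. g \<in> RZ \<Longrightarrow> g \<noteq> 0 \<Longrightarrow> P g \<Longrightarrow> P ([:- x, 1:] * g)"
  shows "P f"
  using assms(1)
proof (induction "degree f" arbitrary: f rule: less_induct)
  case less
  show ?case
  proof (cases "degree f = 0")
    case True
    then show ?thesis
      using const by (metis degree_eq_zeroE)
  next
    case False
    then have "\<not> constant (poly (map_poly complex_of_real f))"
      by (simp add: constant_degree degree_map_poly)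
    then obtain z where z: "poly (map_poly complex_of_real f) z = 0"
      using fundamental_theorem_of_algebra by blast
    with False less.prems have "z \<in> \<real>"
      by (auto simp: RZ_def)
    then obtain x where "z = of_real x"
      by (elim Reals_cases)
    with z have "poly f x = 0"
      by (simp add: poly_map_poly_of_real)
    moreover have "f \<noteq> 0"
      using False by auto
    ultimately obtain g where g: "f = [:- x, 1:] * g" "g \<noteq> 0"
      by (rule linear_factorE)
    then have "degree g < degree f"
      by (metis degree_linear_mult lessI)
    moreover have "g \<in> RZ"
      using less.prems unfolding g(1) linear_mult_in_RZ_iff .
    ultimately have "P ([:- x, 1:] * g)"
      using g(2) less.hyps linear_mult by blast
    then show ?thesis
      unfolding g(1) .
  qed
qed

lemma size_proots_RZ: "f \<in> RZ \<Longrightarrow> size (proots f) = degree f"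
  by (induction rule: RZ_induct) (simp_all add: proots_linear_mult degree_linear_mult del: mult_pCons_left)

lemma in_RZ_if_size_proots: "size (proots f) = degree f \<Longrightarrow> f \<in> RZ"
proof (induction "degree f" arbitrary: f)
  case 0
  then obtain c where "f = [:c:]"
    by (metis degree_eq_zeroE)
  then show ?case
    by (auto simp: RZ_def map_poly_pCons)
next
  case (Suc n)
  then obtain x where "x \<in># proots f"
    by (metis multiset_nonemptyE size_empty nat.distinct(1))
  moreover have "f \<noteq> 0"
    using Suc.hyps by auto
  ultimately have "poly f x = 0"
    by simp
  then obtain g where g: "f = [:- x, 1:] * g" "g \<noteq> 0"
    using \<open>f \<noteq> 0\<close> by (rule linear_factorE)
  then have "size (proots g) = degree g" "n = degree g"
    using Suc.hyps(2) Suc.prems by (simp_all add: proots_linear_mult degree_linear_mult del: mult_pCons_left)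
  then show ?case
    unfolding g(1) linear_mult_in_RZ_iff by (intro Suc.hyps(1))
qed

definition roots_above :: "real poly \<Rightarrow> real \<Rightarrow> nat" where
  "roots_above f x = size {#y \<in># proots f. x < y#}"

lemma roots_above_linear_mult:
  "g \<noteq> 0 \<Longrightarrow>
    roots_above ([:- a, 1:] * g) x = (if x < a then Suc (roots_above g x) else roots_above g x)"
  by (simp add: roots_above_def proots_linear_mult del: mult_pCons_left)

lemma sgn_poly_RZ:
  assumes "f \<in> RZ" "poly f x \<noteq> 0"
  shows "sgn (poly f x) = (-1) ^ roots_above f x * sgn (lead_coeff f)"
  using assms
proof (induction rule: RZ_induct)
  case (const c)
  then show ?case
    by (simp add: roots_above_def)
next
  case (linear_mult a g)
  have "sgn (poly ([:- a, 1:] * g) x) = sgn (x - a) * sgn (poly g x)"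
    by (simp add: sgn_mult[symmetric] algebra_simps)
  also have "\<dots> = sgn (x - a) * ((-1) ^ roots_above g x * sgn (lead_coeff g))"
    using linear_mult by simp
  also have "\<dots> = (-1) ^ roots_above ([:- a, 1:] * g) x * sgn (lead_coeff ([:- a, 1:] * g))"
    using linear_mult.prems linear_mult.hyps
    by (auto simp: roots_above_linear_mult lead_coeff_mult sgn_if simp del: mult_pCons_left)
  finally show ?case .
qed

lemma sgn_pderiv_RZ:
  assumes "f \<in> RZ" "f \<noteq> 0" "order x f = 1"
  shows "sgn (poly (pderiv f) x) = (-1) ^ roots_above f x * sgn (lead_coeff f)"
proof -
  have "poly f x = 0"
    using assms(3) order_root[of f x] by auto
  then obtain g where g: "f = [:- x, 1:] * g" "g \<noteq> 0"
    using assms(2) by (rule linear_factorE)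
  have "order x f = Suc (order x g)"
    using proots_linear_mult[OF g(2), of x] assms(2) g by (metis count_add_mset count_proots)
  then have "poly g x \<noteq> 0"
    using assms(3) g(2) by (simp add: order_root)
  moreover have "g \<in> RZ"
    using assms(1) unfolding g(1) linear_mult_in_RZ_iff .
  moreover have "poly (pderiv f) x = poly g x"
    by (simp add: g(1) pderiv_mult pderiv_pCons del: mult_pCons_left)
  moreover have "roots_above f x = roots_above g x" "lead_coeff f = lead_coeff g"
    using g by (simp_all add: roots_above_linear_mult lead_coeff_mult del: mult_pCons_left)
  ultimately show ?thesis
    by (simp add: sgn_poly_RZ)
qed

section \<open>The list of zeros\<close>

lemma mset_zeros: "mset (zeros f) = proots f"
  by (simp add: zeros_def)

lemma sorted_zeros: "sorted_wrt (\<ge>) (zeros f)"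
  unfolding zeros_def sorted_wrt_rev by simp

lemma set_zeros: "f \<noteq> 0 \<Longrightarrow> set (zeros f) = {x. poly f x = 0}"
  by (metis mset_zeros set_count_proots set_mset_mset)

lemma length_zeros: "f \<in> RZ \<Longrightarrow> length (zeros f) = degree f"
  by (metis mset_zeros size_mset size_proots_RZ)

lemma poly_zeros_nth: "f \<in> RZ \<Longrightarrow> i < degree f \<Longrightarrow> poly f (zeros f ! i) = 0"
  using nth_mem[of i "zeros f"] length_zeros[of f] set_zeros[of f] by fastforce

lemma roots_above_eqI:
  assumes f: "f \<in> RZ" and "k \<le> degree f"
    and "\<And>i. i < k \<Longrightarrow> x < zeros f ! i"
    and "\<And>i. k \<le> i \<Longrightarrow> i < degree f \<Longrightarrow> zeros f ! i \<le> x"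
  shows "roots_above f x = k"
proof -
  have "roots_above f x = length (filter ((<) x) (zeros f))"
    by (simp add: roots_above_def flip: mset_zeros mset_filter)
  also have "\<dots> = card {i. i < degree f \<and> x < zeros f ! i}"
    by (simp add: length_filter_conv_card length_zeros[OF f])
  also have "{i. i < degree f \<and> x < zeros f ! i} = {..<k}"
    using assms by (auto simp: not_le[symmetric])
  finally show ?thesis
    by simp
qed

lemma mset_eq_proots_if_distinct_roots:
  assumes "f \<noteq> 0" "distinct xs" "length xs = degree f"
    and "\<And>x. x \<in> set xs \<Longrightarrow> poly f x = 0"
  shows "mset xs = proots f"
proof -
  have "mset xs \<subseteq># proots f"
  proof (rule mset_subset_eqI)
    fix x
    show "count (mset xs) x \<le> count (proots f) x"
      using assms order_root[of f x] distinct_count_atmost_1[of xs]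
      by (cases "x \<in> set xs") (auto simp: not_in_iff)
  qed
  then show ?thesis
    using assms(3) size_proots_le[of f]
    by (metis mset_subset_size not_le size_mset subset_mset.le_imp_less_or_eq)
qed

lemma RZ_and_zeros_eqI:
  assumes "f \<noteq> 0" "sorted_wrt (>) xs" "length xs = degree f"
    and "\<And>x. x \<in> set xs \<Longrightarrow> poly f x = 0"
  shows "f \<in> RZ" and "zeros f = xs"
proof -
  have "sorted_wrt (<) (rev xs)"
    using assms(2) by (simp add: sorted_wrt_rev)
  then have "distinct xs" "sort (rev xs) = rev xs"
    by (auto simp: strict_sorted_iff sorted_sort_id)
  then have proots: "proots f = mset xs"
    using mset_eq_proots_if_distinct_roots[OF assms(1) _ assms(3,4)] by simp
  show "f \<in> RZ"
    using assms(3) by (intro in_RZ_if_size_proots) (simp add: proots)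
  show "zeros f = xs"
    using \<open>sort (rev xs) = rev xs\<close> unfolding zeros_def proots
    by (metis mset_rev rev_rev_ident sorted_list_of_multiset_mset)
qed

section \<open>Interlacing\<close>

lemma degree_1_imp_RZ:
  assumes "degree f = 1"
  shows "f \<in> RZ"
proof -
  obtain a b where f: "f = [:b, a:]" "a \<noteq> 0"
    using assms by (rule degree1_coeffs)
  then have "f = smult a [:b / a, 1:]"
    by simp
  then have "proots f = {#- (b / a)#}"
    using f(2) by (metis proots_linear_factor proots_smult)
  then show ?thesis
    using f by (intro in_RZ_if_size_proots) simp
qed

lemma strictly_interlaces_iff:
  assumes "g \<noteq> 0" and deg: "degree f = Suc (degree g)"
  shows "g \<prec> f \<longleftrightarrow> interlaces g f \<and> \<not> (\<exists>x. poly f x = 0 \<and> poly g x = 0)"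
proof -
  have "interlaces g f \<and> \<not> (\<exists>x. poly f x = 0 \<and> poly g x = 0)" if g: "g = [:a:]" for a
  proof -
    have "f \<in> RZ" "g \<in> RZ"
      using deg by (auto simp: g degree_1_imp_RZ intro: in_RZ_if_size_proots)
    then show ?thesis
      using assms by (auto simp: g interlaces_def)
  qed
  then show ?thesis
    by (auto simp: strictly_interlaces_def)
qed

context
  fixes f g :: "real poly"
  assumes interlaced: "g \<prec> f" and nonzero: "g \<noteq> 0" and degree: "degree f = Suc (degree g)"
begin

lemma strictly_interlaces_imp_RZ: "g \<in> RZ" "f \<in> RZ"
  using interlaced by (auto simp: strictly_interlaces_iff[OF nonzero degree] interlaces_def)

lemma strictly_interlaces_zeros_less:
  assumes "i < degree g"
  shows "zeros f ! Suc i < zeros g ! i" and "zeros g ! i < zeros f ! i"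
proof -
  have "zeros f ! Suc i \<le> zeros g ! i" "zeros g ! i \<le> zeros f ! i"
    and "\<not> (poly f x = 0 \<and> poly g x = 0)" for x
    using interlaced assms by (auto simp: strictly_interlaces_iff[OF nonzero degree] interlaces_def)
  moreover have "poly g (zeros g ! i) = 0" "poly f (zeros f ! i) = 0" "poly f (zeros f ! Suc i) = 0"
    using assms degree strictly_interlaces_imp_RZ by (simp_all add: poly_zeros_nth)
  ultimately show "zeros f ! Suc i < zeros g ! i" "zeros g ! i < zeros f ! i"
    by (metis less_eq_real_def)+
qed

lemma strictly_interlaces_strict_sorted_zeros: "sorted_wrt (>) (zeros f)"
proof -
  have "zeros f ! Suc i < zeros f ! i" if "Suc i < length (zeros f)" for i
    using strictly_interlaces_zeros_less[of i] that degree length_zeros[OF strictly_interlaces_imp_RZ(2)]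
    by simp
  then show ?thesis
    by (subst sorted_wrt_iff_nth_Suc_transp) (auto intro: transpI)
qed

lemma strictly_interlaces_roots_above:
  assumes "k \<le> degree g"
  shows "roots_above g (zeros f ! k) = k" and "roots_above f (zeros f ! k) = k"
proof -
  have zeros_f_le: "zeros f ! j \<le> zeros f ! i" if "i \<le> j" "j \<le> degree g" for i j
    using that sorted_wrt_nth_less[OF sorted_zeros, of i j f] degree
      length_zeros[OF strictly_interlaces_imp_RZ(2)]
    by (cases "i = j") auto
  show "roots_above g (zeros f ! k) = k"
  proof (rule roots_above_eqI[OF strictly_interlaces_imp_RZ(1) assms])
    show "zeros f ! k < zeros g ! i" if "i < k" for i
      using strictly_interlaces_zeros_less(1)[of i] zeros_f_le[of "Suc i" k] that assms by simp
    show "zeros g ! i \<le> zeros f ! k" if "k \<le> i" "i < degree g" for i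
      using strictly_interlaces_zeros_less(2)[of i] zeros_f_le[of k i] that by simp
  qed
  show "roots_above f (zeros f ! k) = k"
  proof (rule roots_above_eqI[OF strictly_interlaces_imp_RZ(2)])
    show "zeros f ! k < zeros f ! i" if "i < k" for i
      using that assms degree strictly_interlaces_strict_sorted_zeros
        length_zeros[OF strictly_interlaces_imp_RZ(2)] by (auto dest: sorted_wrt_nth_less)
  qed (use assms degree zeros_f_le in auto)
qed

lemma strictly_interlaces_order_zeros:
  assumes "k \<le> degree g"
  shows "order (zeros f ! k) f = 1"
proof -
  have "k < length (zeros f)" "f \<noteq> 0"
    using assms degree length_zeros[OF strictly_interlaces_imp_RZ(2)] by auto
  moreover have "distinct (zeros f)"
    using strictly_interlaces_strict_sorted_zeros
    by (metis distinct_rev sorted_wrt_rev strict_sorted_iff)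
  ultimately show ?thesis
    by (metis count_mset_0_iff count_proots distinct_count_atmost_1 mset_zeros nth_mem)
qed

lemma sgn_poly_at_interlacing_zeros:
  assumes "lead_coeff g > 0" and "k \<le> degree g"
  shows "sgn (poly g (zeros f ! k)) = (-1) ^ k"
proof -
  have "poly f (zeros f ! k) = 0"
    using assms(2) degree by (intro poly_zeros_nth strictly_interlaces_imp_RZ(2)) simp
  then have "poly g (zeros f ! k) \<noteq> 0"
    using interlaced by (auto simp: strictly_interlaces_iff[OF nonzero degree])
  then show ?thesis
    using sgn_poly_RZ[OF strictly_interlaces_imp_RZ(1)] strictly_interlaces_roots_above(1) assms by simp
qed

lemma sgn_pderiv_at_interlaced_zeros:
  assumes "lead_coeff f > 0" and "k \<le> degree g"
  shows "sgn (poly (pderiv f) (zeros f ! k)) = (-1) ^ k"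
proof -
  have "f \<noteq> 0"
    using degree by auto
  then show ?thesis
    using sgn_pderiv_RZ[OF strictly_interlaces_imp_RZ(2) _ strictly_interlaces_order_zeros[OF assms(2)]]
      strictly_interlaces_roots_above(2)[OF assms(2)] assms(1) by simp
qed

end

section \<open>Sign changes\<close>

lemma eventually_sgn_poly_at_top:
  fixes f :: "real poly"
  shows "eventually (\<lambda>x. sgn (poly f x) = sgn (lead_coeff f)) at_top"
proof -
  have eventually_pos: "eventually (\<lambda>x. poly g x > 0) at_top" if "lead_coeff g > 0" for g :: "real poly"
    using poly_pinfty_gt_lc[OF that] that by (auto simp: eventually_at_top_linorder intro: less_le_trans)
  consider (zero) "f = 0" | (pos) "lead_coeff f > 0" | (neg) "lead_coeff (- f) > 0"
    by fastforce
  then show ?thesis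
  proof cases
    case pos
    then show ?thesis
      using eventually_pos[of f] by (auto elim: eventually_mono)
  next
    case neg
    then show ?thesis
      using eventually_pos[of "- f"] by (auto elim: eventually_mono)
  qed simp
qed

lemma eventually_sgn_poly_at_bot:
  fixes f :: "real poly"
  shows "eventually (\<lambda>x. sgn (poly f x) = (-1) ^ degree f * sgn (lead_coeff f)) at_bot"
proof -
  have "lead_coeff (pcompose f [:0, -1:]) = (-1) ^ degree f * lead_coeff f"
    by (subst lead_coeff_comp) simp_all
  then show ?thesis
    using eventually_sgn_poly_at_top[of "pcompose f [:0, -1:]"]
    by (cases "even (degree f)") (simp_all add: at_bot_mirror eventually_filtermap poly_pcompose sgn_mult)
qed

lemma zeros_between_sign_changes:
  fixes f :: "real poly"
  assumes "\<And>i. i < n \<Longrightarrow> t (Suc i) \<le> t i"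
    and "\<And>i. i \<le> n \<Longrightarrow> sgn (poly f (t i)) = (-1) ^ i"
  obtains s where "\<And>i. i < n \<Longrightarrow> t (Suc i) < s i \<and> s i < t i \<and> poly f (s i) = 0"
proof -
  have "\<exists>x. t (Suc i) < x \<and> x < t i \<and> poly f x = 0" if "i < n" for i
  proof -
    have "sgn (poly f (t (Suc i)) * poly f (t i)) = -1"
      using assms(2)[of i] assms(2)[of "Suc i"] that by (simp add: sgn_mult)
    then have "poly f (t (Suc i)) * poly f (t i) < 0"
      by (simp add: sgn_1_neg)
    moreover from this have "t (Suc i) < t i"
      using assms(1)[OF that] by (metis less_eq_real_def not_square_less_zero)
    ultimately show ?thesis
      using poly_IVT by blast
  qed
  then show thesis
    using that by metis
qed

lemma bounds_with_end_signs:
  fixes f :: "real poly"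
  assumes "finite A"
  obtains a b where "a < b" "\<And>x. x \<in> A \<Longrightarrow> a < x \<and> x < b"
    "sgn (poly f a) = (-1) ^ degree f * sgn (lead_coeff f)" "sgn (poly f b) = sgn (lead_coeff f)"
proof -
  have "eventually (\<lambda>x. (\<forall>y\<in>A. x < y) \<and>
      sgn (poly f x) = (-1) ^ degree f * sgn (lead_coeff f)) at_bot"
    using assms eventually_sgn_poly_at_bot[of f]
    by (auto simp: eventually_conj_iff eventually_ball_finite_distrib eventually_gt_at_bot)
  then obtain a where a: "\<forall>y\<in>A. a < y" "sgn (poly f a) = (-1) ^ degree f * sgn (lead_coeff f)"
    by (auto dest: eventually_happens)
  have "eventually (\<lambda>x. (\<forall>y\<in>insert a A. y < x) \<and> sgn (poly f x) = sgn (lead_coeff f)) at_top"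
    using assms eventually_sgn_poly_at_top[of f]
    by (auto simp: eventually_conj_iff eventually_ball_finite_distrib eventually_gt_at_top)
  then obtain b where "\<forall>y\<in>insert a A. y < b" "sgn (poly f b) = sgn (lead_coeff f)"
    by (auto dest: eventually_happens)
  with a show thesis
    by (intro that[of a b]) auto
qed

lemma alternating_imp_interlaced_zeros:
  assumes f: "f \<in> RZ" and deg: "degree h = Suc (degree f)" and lc: "lead_coeff h > 0"
    and alternating: "\<And>i. i < degree f \<Longrightarrow> sgn (poly h (zeros f ! i)) = (-1) ^ Suc i"
  obtains s where "\<And>i. i \<le> degree f \<Longrightarrow> poly h (s i) = 0"
    and "\<And>i. i < degree f \<Longrightarrow> s (Suc i) < zeros f ! i \<and> zeros f ! i < s i"
proof -
  define n where "n = degree f"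
  have len: "length (zeros f) = n"
    by (simp add: n_def length_zeros[OF f])
  obtain a b where ab: "a < b" "\<And>x. x \<in> set (zeros f) \<Longrightarrow> a < x \<and> x < b"
    and sgn_ab: "sgn (poly h a) = (-1) ^ Suc n" "sgn (poly h b) = 1"
    using bounds_with_end_signs[of "set (zeros f)" h] deg lc by (auto simp: n_def)
  define t where "t = b # zeros f @ [a]"
  have t_Suc: "t ! Suc i = zeros f ! i" if "i < n" for i
    using that by (simp add: t_def len nth_append)
  have "sorted_wrt (\<ge>) t"
    using ab sorted_zeros[of f] by (auto simp: t_def sorted_wrt_append less_imp_le)
  then have "t ! Suc i \<le> t ! i" if "i < Suc n" for i
    using sorted_wrt_nth_less[of "(\<ge>)" t i "Suc i"] that by (simp add: t_def len)
  moreover have "sgn (poly h (t ! i)) = (-1) ^ i" if "i \<le> Suc n" for i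
  proof (cases i)
    case 0
    then show ?thesis
      using sgn_ab(2) by (simp add: t_def)
  next
    case (Suc j)
    then show ?thesis
      using that sgn_ab(1) alternating[of j] by (cases "j = n") (auto simp: t_def len nth_append n_def)
  qed
  ultimately obtain s
    where s: "\<And>i. i < Suc n \<Longrightarrow> t ! Suc i < s i \<and> s i < t ! i \<and> poly h (s i) = 0"
    using zeros_between_sign_changes[of "Suc n" "(!) t" h] by blast
  show thesis
    using s s[of "Suc _"] by (intro that[of s]) (auto simp: n_def simp flip: t_Suc)
qed

lemma strictly_interlaces_if_alternating:
  assumes f: "f \<in> RZ" "f \<noteq> 0" and deg: "degree h = Suc (degree f)" and lc: "lead_coeff h > 0"
    and alternating: "\<And>i. i < degree f \<Longrightarrow> sgn (poly h (zeros f ! i)) = (-1) ^ Suc i"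
  shows "f \<prec> h"
proof -
  obtain s where roots: "\<And>i. i \<le> degree f \<Longrightarrow> poly h (s i) = 0"
    and between: "\<And>i. i < degree f \<Longrightarrow> s (Suc i) < zeros f ! i \<and> zeros f ! i < s i"
    using alternating_imp_interlaced_zeros[OF f(1) deg lc alternating] by blast
  let ?ss = "map s [0..<degree h]"
  have "h \<noteq> 0"
    using lc by auto
  moreover have "sorted_wrt (>) ?ss"
    using between deg
    by (subst sorted_wrt_iff_nth_Suc_transp) (auto intro: transpI less_trans simp del: upt_Suc)
  moreover have "length ?ss = degree h"
    by simp
  moreover have "poly h x = 0" if "x \<in> set ?ss" for x
    using roots that deg by (auto simp: less_Suc_eq_le)
  ultimately have h: "h \<in> RZ" "zeros h = ?ss"
    using RZ_and_zeros_eqI by blast+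
  have "interlaces f h"
    using f deg h \<open>h \<noteq> 0\<close> between by (auto simp: interlaces_def less_imp_le simp del: upt_Suc)
  moreover have "poly h x \<noteq> 0" if "poly f x = 0" for x
  proof -
    have "x \<in> set (zeros f)"
      using that by (simp add: set_zeros[OF f(2)])
    then obtain i where "i < degree f" "x = zeros f ! i"
      by (auto simp: in_set_conv_nth length_zeros[OF f(1)])
    then show ?thesis
      using alternating[of i] by auto
  qed
  ultimately show ?thesis
    using f(2) deg by (auto simp: strictly_interlaces_iff)
qed

section \<open>Three-term recurrences involving the derivative\<close>

lemma strictly_interlaces_recurrence:
  assumes gf: "g \<prec> f"
    and lc_g: "lead_coeff g > 0" and lc_f: "lead_coeff f > 0" and lc_h: "lead_coeff h > 0"
    and deg_f: "degree f = Suc (degree g)" and deg_h: "degree h = Suc (degree f)"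
    and "k > 0" and rec: "smult k h = a * f + b * pderiv f + c * g"
    and b_nonpos: "\<And>x. poly f x = 0 \<Longrightarrow> poly b x \<le> 0"
    and c_nonpos: "\<And>x. poly f x = 0 \<Longrightarrow> poly c x \<le> 0"
    and bc_neg: "\<And>x. poly f x = 0 \<Longrightarrow> poly b x + poly c x < 0"
  shows "f \<prec> h"
proof -
  have "g \<noteq> 0"
    using lc_g by auto
  note interlaced = gf this deg_f
  note f_RZ = strictly_interlaces_imp_RZ(2)[OF interlaced]
  have "sgn (poly h (zeros f ! i)) = (-1) ^ Suc i" if i: "i < degree f" for i
  proof -
    let ?x = "zeros f ! i"
    have root: "poly f ?x = 0"
      using f_RZ i by (rule poly_zeros_nth)
    have sgn_g: "sgn (poly g ?x) = (-1) ^ i"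
      using sgn_poly_at_interlacing_zeros[OF interlaced lc_g] i deg_f by simp
    have sgn_f': "sgn (poly (pderiv f) ?x) = (-1) ^ i"
      using sgn_pderiv_at_interlaced_zeros[OF interlaced lc_f] i deg_f by simp
    have "k * poly h ?x = poly b ?x * poly (pderiv f) ?x + poly c ?x * poly g ?x"
      using arg_cong[OF rec, of "\<lambda>p. poly p ?x"] root by simp
    then have "(-1) ^ i * (k * poly h ?x) =
        poly b ?x * \<bar>poly (pderiv f) ?x\<bar> + poly c ?x * \<bar>poly g ?x\<bar>"
      by (simp add: abs_sgn sgn_f' sgn_g algebra_simps)
    moreover have "\<bar>poly (pderiv f) ?x\<bar> > 0" "\<bar>poly g ?x\<bar> > 0"
      using sgn_f' sgn_g by fastforce+
    ultimately have "(-1) ^ i * (k * poly h ?x) < 0"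
      using b_nonpos[OF root] c_nonpos[OF root] bc_neg[OF root]
      by (smt (verit) mult_neg_pos mult_nonpos_nonneg)
    then show ?thesis
      using \<open>k > 0\<close> by (cases "even i") (auto simp: mult_less_0_iff zero_less_mult_iff)
  qed
  then show ?thesis
    using f_RZ deg_h lc_h lc_f by (intro strictly_interlaces_if_alternating) auto
qed

lemma Sturm_sequence_if_recurrence:
  assumes deg: "\<And>n. degree (f n) = n" and lc: "\<And>n. lead_coeff (f n) > 0"
    and k_pos: "\<And>n. k n > 0"
    and rec: "\<And>n. smult (k n) (f (Suc (Suc n))) =
      a n * f (Suc n) + b n * pderiv (f (Suc n)) + c n * f n"
    and "\<And>n x. poly (f (Suc n)) x = 0 \<Longrightarrow> poly (b n) x \<le> 0"
    and "\<And>n x. poly (f (Suc n)) x = 0 \<Longrightarrow> poly (c n) x \<le> 0"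
    and "\<And>n x. poly (f (Suc n)) x = 0 \<Longrightarrow> poly (b n) x + poly (c n) x < 0"
  shows "Sturm_sequence f"
proof -
  have interlaced: "f n \<prec> f (Suc n)" for n
  proof (induction n)
    case 0
    obtain c where "f 0 = [:c:]"
      using deg[of 0] by (rule degree_eq_zeroE)
    moreover obtain a b where "f (Suc 0) = [:b, a:]"
      using deg[of 1] by (metis One_nat_def degree1_coeffs)
    ultimately show ?case
      by (auto simp: strictly_interlaces_def)
  next
    case (Suc n)
    then show ?case
      by (rule strictly_interlaces_recurrence[OF _ lc lc lc _ _ k_pos rec]) (use assms in auto)
  qed
  have "f n \<noteq> 0" for n
    using lc[of n] by auto
  then show ?thesis
    using interlaced lc strictly_interlaces_imp_RZ(1)[OF interlaced]
    by (auto simp: Sturm_sequence_def standard_poly_def deg)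
qed

section \<open>Borel transform\<close>

definition borel_transform :: "'a :: field_char_0 poly \<Rightarrow> 'a poly" where
  "borel_transform p = (\<Sum>i\<le>degree p. monom (coeff p i / fact i) i)"

lemma coeff_borel_transform: "coeff (borel_transform p) i = coeff p i / fact i"
  by (auto simp: borel_transform_def coeff_sum coeff_eq_0)

lemma degree_borel_transform: "degree (borel_transform p) = degree p"
  by (simp add: degree_def coeff_borel_transform)

lemma borel_transform_add: "borel_transform (p + q) = borel_transform p + borel_transform q"
  by (intro poly_eqI) (simp add: coeff_borel_transform add_divide_distrib)

lemma borel_transform_diff: "borel_transform (p - q) = borel_transform p - borel_transform q"
  by (intro poly_eqI) (simp add: coeff_borel_transform diff_divide_distrib)

lemma borel_transform_smult: "borel_transform (smult c p) = smult c (borel_transform p)"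
  by (intro poly_eqI) (simp add: coeff_borel_transform)

lemma borel_transform_pCons_pderiv:
  "borel_transform (pCons 0 (pderiv p)) = pCons 0 (pderiv (borel_transform p))"
  by (intro poly_eqI)
    (simp add: coeff_borel_transform coeff_pCons coeff_pderiv del: of_nat_Suc split: nat.split)

lemma borel_transform_pCons_pderiv_pCons:
  "borel_transform (pCons 0 (pderiv (pCons 0 p))) = pCons 0 (borel_transform p)"
  by (intro poly_eqI)
    (simp add: coeff_borel_transform coeff_pCons coeff_pderiv del: of_nat_Suc split: nat.split)

section \<open>Positive coefficients\<close>

lemma pcompose_conv_sum:
  "pcompose p q = (\<Sum>i\<le>degree p. smult (coeff p i) (q ^ i))" for p q :: "'a :: comm_ring_1 poly"
proof -
  have pcompose_monom: "pcompose (monom c i) q = smult c (q ^ i)" for c i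
    by (induction i) (simp_all add: monom_0 monom_Suc pcompose_pCons)
  have "pcompose p q = pcompose (\<Sum>i\<le>degree p. monom (coeff p i) i) q"
    by (simp add: poly_as_sum_of_monoms)
  also have "\<dots> = (\<Sum>i\<le>degree p. smult (coeff p i) (q ^ i))"
    by (simp add: pcompose_sum pcompose_monom)
  finally show ?thesis .
qed

lemma coeff_pcompose_shift_pos:
  fixes p :: "'a :: linordered_idom poly"
  assumes "\<And>j. coeff p j \<ge> 0" and "lead_coeff p > 0" and "i \<le> degree p"
  shows "coeff (pcompose p [:1, 1:]) i > 0"
proof -
  have coeff_power: "coeff ([:1, 1:] ^ j) i = (of_nat (j choose i) :: 'a)" for j
    by (cases "i \<le> j") (simp_all add: coeff_linear_poly_power coeff_eq_0 degree_linear_power)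
  have "0 < lead_coeff p * of_nat (degree p choose i)"
    using assms by simp
  also have "\<dots> \<le> (\<Sum>j\<le>degree p. coeff p j * of_nat (j choose i))"
    by (rule member_le_sum) (use assms(1) in auto)
  also have "\<dots> = coeff (pcompose p [:1, 1:]) i"
    by (simp add: pcompose_conv_sum coeff_sum coeff_power)
  finally show ?thesis .
qed

lemma poly_pos_if_coeffs_nonneg:
  fixes p :: "'a :: linordered_idom poly"
  assumes "\<And>i. coeff p i \<ge> 0" and "coeff p 0 > 0" and "x \<ge> 0"
  shows "poly p x > 0"
proof -
  have "coeff p 0 * x ^ 0 \<le> (\<Sum>i\<le>degree p. coeff p i * x ^ i)"
    using assms by (intro member_le_sum) auto
  then show ?thesis
    using assms(2) by (simp add: poly_altdef)
qed

section \<open>The polynomials \<open>P\<^sub>n\<close> in powers of \<open>x + 1\<close>\<close>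

text \<open>The case distinction is needed because for \<open>j > n\<close> the truncated subtractions would make the
  first binomial coefficient \<open>1\<close>.\<close>

definition BM_shifted_coeff :: "nat \<Rightarrow> nat \<Rightarrow> real" where
  "BM_shifted_coeff n j = (if j \<le> n then 2 ^ j * real ((2 * n - 2 * j) choose (n - j))
     * real ((n + j) choose j) / 4 ^ n else 0)"

lemma BM_shifted_coeff_pos: "j \<le> n \<Longrightarrow> BM_shifted_coeff n j > 0"
  by (simp add: BM_shifted_coeff_def)

lemma BM_shifted_coeff_eq_0: "n < j \<Longrightarrow> BM_shifted_coeff n j = 0"
  by (simp add: BM_shifted_coeff_def)

lemma BM_shifted_coeff_fact:
  "BM_shifted_coeff (j + k) j =
     2 ^ j * fact (2 * k) * fact (2 * j + k) / (4 ^ (j + k) * (fact k)\<^sup>2 * fact j * fact (j + k))"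
proof -
  have "real ((2 * (j + k) - 2 * j) choose (j + k - j)) = fact (2 * k) / (fact k)\<^sup>2"
    by (simp add: binomial_fact power2_eq_square)
  moreover have "real ((j + k + j) choose j) = fact (2 * j + k) / (fact j * fact (j + k))"
    by (simp add: binomial_fact mult_2 add_ac)
  ultimately show ?thesis
    by (simp add: BM_shifted_coeff_def)
qed

lemma BM_shifted_coeff_Suc_row:
  "2 * (real n - real j + 1) * (real n + 1) * BM_shifted_coeff (Suc n) j =
     (2 * (real n - real j) + 1) * (real n + real j + 1) * BM_shifted_coeff n j"
proof -
  consider (inside) k where "n = j + k" | (border) "j = Suc n" | (outside) "Suc n < j"
    by (metis le_Suc_ex linorder_not_less not_less_eq_eq le_antisym Suc_leI)
  then show ?thesis
  proof cases
    case inside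
    show ?thesis
      unfolding inside BM_shifted_coeff_fact[of j "Suc k", unfolded add_Suc_right] BM_shifted_coeff_fact
      by (simp add: divide_simps add_eq_0_iff) (simp add: algebra_simps power2_eq_square)
  qed (simp_all add: BM_shifted_coeff_eq_0)
qed

lemma BM_shifted_coeff_Suc_column:
  "(2 * (real n - real j) - 1) * (real j + 1) * BM_shifted_coeff n (Suc j) =
     (real n - real j) * (real n + real j + 1) * BM_shifted_coeff n j"
proof -
  consider (inside) k where "n = Suc (j + k)" | (border) "j = n" | (outside) "n < j"
    by (metis less_imp_Suc_add linorder_neqE_nat)
  then show ?thesis
  proof cases
    case inside
    show ?thesis
      unfolding inside BM_shifted_coeff_fact[of "Suc j" k, unfolded add_Suc]
        BM_shifted_coeff_fact[of j "Suc k", unfolded add_Suc_right]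
      by (simp add: divide_simps add_eq_0_iff) (simp add: algebra_simps power2_eq_square)
  qed (simp_all add: BM_shifted_coeff_eq_0)
qed

lemma BM_shifted_coeff_pred_column:
  "(real n - real j + 1) * (real n + real j) * (real j * BM_shifted_coeff n (j - 1)) =
     (2 * (real n - real j) + 1) * (real j)\<^sup>2 * BM_shifted_coeff n j"
proof (cases j)
  case (Suc i)
  have "(real n - real j + 1) * (real n + real j) * BM_shifted_coeff n (j - 1) =
      (2 * (real n - real j) + 1) * real j * BM_shifted_coeff n j"
    using BM_shifted_coeff_Suc_column[of n i] by (simp add: Suc algebra_simps)
  then show ?thesis
    by algebra
qed simp

lemma BM_shifted_coeff_Suc_diagonal:
  "2 * (real j + 1) * (real n + 1) * BM_shifted_coeff (Suc n) (Suc j) =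
     (real n + real j + 2) * (real n + real j + 1) * BM_shifted_coeff n j"
proof (cases "j \<le> n")
  case True
  then obtain k where n: "n = j + k"
    by (metis le_Suc_ex)
  show ?thesis
    unfolding n BM_shifted_coeff_fact[of "Suc j" k, unfolded add_Suc] BM_shifted_coeff_fact
    by (simp add: divide_simps add_eq_0_iff) (simp add: algebra_simps power2_eq_square)
qed (simp add: BM_shifted_coeff_eq_0)

lemma BM_shifted_coeff_rec:
  fixes n :: nat
  defines "m \<equiv> real n + 1"
  shows "4 * (m + 1)\<^sup>2 * BM_shifted_coeff (Suc (Suc n)) j =
    (16 * m\<^sup>2 + 16 * m + 6) * BM_shifted_coeff (Suc n) j
    + 4 * (j * BM_shifted_coeff (Suc n) j - (j + 1) * BM_shifted_coeff (Suc n) (Suc j))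
    + 4 * (2 * m + 1) * (j * BM_shifted_coeff (Suc n) (j - 1)
        - (2 * j + 1) * BM_shifted_coeff (Suc n) j + (j + 1) * BM_shifted_coeff (Suc n) (Suc j))
    - (16 * m\<^sup>2 - 1) * BM_shifted_coeff n j"
proof (cases "j = Suc (Suc n)")
  text \<open>Every term is a rational multiple of \<open>BM_shifted_coeff (Suc n) j\<close>, except that this coefficient
    vanishes for \<open>j = n + 2\<close> while two of the terms do not.\<close>
  case True
  then show ?thesis
    using BM_shifted_coeff_Suc_diagonal[of "Suc n" "Suc n"]
    by (simp add: BM_shifted_coeff_eq_0 m_def algebra_simps power2_eq_square)
next
  case False
  define p where "p = real j"
  define c where "c = BM_shifted_coeff (Suc n) j"
  define c_left where "c_left = BM_shifted_coeff (Suc n) (j - 1)"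
  define c_right where "c_right = BM_shifted_coeff (Suc n) (Suc j)"
  define c_below where "c_below = BM_shifted_coeff n j"
  define c_above where "c_above = BM_shifted_coeff (Suc (Suc n)) j"
  note defs = m_def p_def c_def c_left_def c_right_def c_below_def c_above_def
  have below: "2 * (m - p) * m * c = (2 * (m - p) - 1) * (m + p) * c_below"
    using BM_shifted_coeff_Suc_row[of n j] by (simp add: defs algebra_simps)
  have above: "2 * (m - p + 1) * (m + 1) * c_above = (2 * (m - p) + 1) * (m + p + 1) * c"
    using BM_shifted_coeff_Suc_row[of "Suc n" j] by (simp add: defs algebra_simps)
  have right: "(2 * (m - p) - 1) * ((p + 1) * c_right) = (m - p) * (m + p + 1) * c"
    using BM_shifted_coeff_Suc_column[of "Suc n" j] by (simp add: defs algebra_simps)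
  have left: "(m - p + 1) * (m + p) * (p * c_left) = (2 * (m - p) + 1) * p\<^sup>2 * c"
    using BM_shifted_coeff_pred_column[of "Suc n" j] by (simp add: defs add.commute)
  have "real j \<noteq> real (Suc (Suc n))" "real (2 * Suc n) \<noteq> real (2 * j + 1)"
    unfolding of_nat_eq_iff using False by presburger+
  then have "(2 * (m - p) - 1) * (m - p + 1) * (m + p) \<noteq> 0"
    by (simp add: m_def p_def)
  moreover have "(2 * (m - p) - 1) * (m - p + 1) * (m + p) * (4 * (m + 1)\<^sup>2 * c_above) =
    (2 * (m - p) - 1) * (m - p + 1) * (m + p) *
    ((16 * m\<^sup>2 + 16 * m + 6) * c
      + 4 * (p * c - (p + 1) * c_right)
      + 4 * (2 * m + 1) * (p * c_left - (2 * p + 1) * c + (p + 1) * c_right)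
      - (16 * m\<^sup>2 - 1) * c_below)"
    using below above right left by algebra
  ultimately show ?thesis
    by (simp only: mult_cancel_left simp_thms defs)
qed

definition BM_shifted :: "nat \<Rightarrow> real poly" where
  "BM_shifted n = (\<Sum>j\<le>n. monom (BM_shifted_coeff n j) j)"

lemma coeff_BM_shifted: "coeff (BM_shifted n) j = BM_shifted_coeff n j"
  by (auto simp: BM_shifted_def coeff_sum BM_shifted_coeff_eq_0)

lemma degree_BM_shifted: "degree (BM_shifted n) = n"
  using BM_shifted_coeff_pos[of n n]
  by (intro antisym degree_le le_degree) (auto simp: coeff_BM_shifted BM_shifted_coeff_eq_0)

lemma BM_P_eq_pcompose: "BM_P n = pcompose (BM_shifted n) [:1, 1:]"
proof -
  have "smult (1 / 2 ^ (2 * n)) (\<Sum>j=0..n. smult (c j) (q j)) = (\<Sum>j\<le>n. smult (c j / 4 ^ n) (q j))"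
    for c :: "nat \<Rightarrow> real" and q
    by (intro poly_eqI) (simp add: coeff_sum sum_distrib_left atMost_atLeast0 power_mult)
  then show ?thesis
    by (simp add: BM_P_def pcompose_conv_sum degree_BM_shifted coeff_BM_shifted BM_shifted_coeff_def)
qed

lemma degree_BM_P: "degree (BM_P n) = n"
  by (simp add: BM_P_eq_pcompose degree_pcompose degree_BM_shifted)

lemma coeff_BM_P_pos:
  assumes "i \<le> n"
  shows "coeff (BM_P n) i > 0"
  unfolding BM_P_eq_pcompose
proof (rule coeff_pcompose_shift_pos)
  show "coeff (BM_shifted n) j \<ge> 0" for j
    using BM_shifted_coeff_pos[of j n]
    by (cases "j \<le> n") (simp_all add: coeff_BM_shifted BM_shifted_coeff_eq_0)
qed (use assms in \<open>simp_all add: coeff_BM_shifted degree_BM_shifted BM_shifted_coeff_pos\<close>)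

lemma coeff_linear_mult_pderiv:
  fixes p :: "'a :: idom poly"
  shows "coeff ([:-1, 1:] * pderiv p) j = of_nat j * coeff p j - (of_nat j + 1) * coeff p (Suc j)"
  by (cases j) (simp_all add: coeff_pderiv)

lemma coeff_linear_mult_pderiv_linear_mult:
  fixes p :: "'a :: idom poly"
  shows "coeff ([:-1, 1:] * pderiv ([:-1, 1:] * p)) j =
    of_nat j * coeff p (j - 1) - (2 * of_nat j + 1) * coeff p j + (of_nat j + 1) * coeff p (Suc j)"
  unfolding coeff_linear_mult_pderiv by (cases j) (simp_all add: algebra_simps)

lemma BM_shifted_rec:
  fixes n :: nat
  defines "m \<equiv> real n + 1"
  shows "smult (4 * (m + 1)\<^sup>2) (BM_shifted (Suc (Suc n))) =
    smult (16 * m\<^sup>2 + 16 * m + 6) (BM_shifted (Suc n))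
    + smult 4 ([:-1, 1:] * pderiv (BM_shifted (Suc n)))
    + smult (4 * (2 * m + 1)) ([:-1, 1:] * pderiv ([:-1, 1:] * BM_shifted (Suc n)))
    - smult (16 * m\<^sup>2 - 1) (BM_shifted n)" (is "?L = ?R")
proof (rule poly_eqI)
  fix j
  show "coeff ?L j = coeff ?R j"
    using BM_shifted_coeff_rec[of n j, folded m_def]
    by (simp only: coeff_add coeff_diff coeff_smult coeff_linear_mult_pderiv_linear_mult coeff_BM_shifted)
      (simp only: coeff_linear_mult_pderiv coeff_BM_shifted)
qed

lemma BM_P_rec:
  fixes n :: nat
  defines "m \<equiv> real n + 1"
  shows "smult (4 * (m + 1)\<^sup>2) (BM_P (Suc (Suc n))) =
    smult (16 * m\<^sup>2 + 16 * m + 6) (BM_P (Suc n))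
    + smult 4 (pCons 0 (pderiv (BM_P (Suc n))))
    + smult (4 * (2 * m + 1)) (pCons 0 (pderiv (pCons 0 (BM_P (Suc n)))))
    - smult (16 * m\<^sup>2 - 1) (BM_P n)"
proof -
  have "pcompose [:-1, 1:] [:1, 1:] = [:0, 1 :: real:]"
    by (simp add: pcompose_pCons)
  then have shift: "pcompose ([:-1, 1:] * pderiv q) [:1, 1:] = pCons 0 (pderiv (pcompose q [:1, 1:]))"
    "pcompose ([:-1, 1:] * q) [:1, 1:] = pCons 0 (pcompose q [:1, 1:])" for q :: "real poly"
    by (simp_all add: pcompose_mult pderiv_pcompose pderiv_pCons del: mult_pCons_left) simp_all
  show ?thesis
    using arg_cong[OF BM_shifted_rec[of n, folded m_def], of "\<lambda>p. pcompose p [:1, 1:]"]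
    by (simp only: pcompose_add pcompose_diff pcompose_smult shift(1) BM_P_eq_pcompose)
      (simp only: shift(2))
qed

section \<open>The polynomials \<open>Q\<^sub>n\<close>\<close>

lemma BM_Q_eq_borel_transform: "BM_Q n = borel_transform (BM_P n)"
  by (simp add: BM_Q_def BM_coeff_def borel_transform_def degree_BM_P atMost_atLeast0)

lemma degree_BM_Q: "degree (BM_Q n) = n"
  by (simp add: BM_Q_eq_borel_transform degree_borel_transform degree_BM_P)

lemma coeff_BM_Q_pos: "i \<le> n \<Longrightarrow> coeff (BM_Q n) i > 0"
  by (simp add: BM_Q_eq_borel_transform coeff_borel_transform coeff_BM_P_pos)

lemma zeros_BM_Q_neg: "poly (BM_Q n) x = 0 \<Longrightarrow> x < 0"
proof (rule ccontr)
  assume "poly (BM_Q n) x = 0" "\<not> x < 0"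
  moreover have "coeff (BM_Q n) i \<ge> 0" for i
    using coeff_BM_Q_pos[of i n] by (cases "i \<le> n") (auto simp: coeff_eq_0 degree_BM_Q)
  ultimately show False
    using poly_pos_if_coeffs_nonneg[of "BM_Q n" x] coeff_BM_Q_pos[of 0 n] by simp
qed

lemma BM_Q_rec:
  fixes n :: nat
  defines "m \<equiv> real n + 1"
  shows "smult (4 * (m + 1)\<^sup>2) (BM_Q (Suc (Suc n))) =
    [:16 * m\<^sup>2 + 16 * m + 6, 4 * (2 * m + 1):] * BM_Q (Suc n)
    + [:0, 4:] * pderiv (BM_Q (Suc n)) + [:1 - 16 * m\<^sup>2:] * BM_Q n"
proof -
  have "smult (4 * (m + 1)\<^sup>2) (BM_Q (Suc (Suc n))) =
    smult (16 * m\<^sup>2 + 16 * m + 6) (BM_Q (Suc n))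
    + smult 4 (pCons 0 (pderiv (BM_Q (Suc n))))
    + smult (4 * (2 * m + 1)) (pCons 0 (BM_Q (Suc n)))
    - smult (16 * m\<^sup>2 - 1) (BM_Q n)"
    using arg_cong[OF BM_P_rec[of n, folded m_def], of borel_transform]
    by (simp only: borel_transform_add borel_transform_diff borel_transform_smult
        borel_transform_pCons_pderiv_pCons BM_Q_eq_borel_transform)
      (simp only: borel_transform_pCons_pderiv)
  then show ?thesis
    by (simp add: smult_diff_left algebra_simps)
qed

theorem theorem2p3:
  shows "Sturm_sequence BM_Q \<and> (\<forall>n\<ge>1. BM_Q n \<in> RZ)"
proof -
  have "Sturm_sequence BM_Q"
  proof (rule Sturm_sequence_if_recurrence[OF degree_BM_Q _ _ BM_Q_rec])
    fix n :: nat and x :: real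
    let ?m = "real n + 1"
    show "lead_coeff (BM_Q n) > 0"
      by (simp add: degree_BM_Q coeff_BM_Q_pos)
    show "4 * (?m + 1)\<^sup>2 > 0"
      by simp
    have "?m\<^sup>2 \<ge> 1"
      by simp
    then have "16 * ?m\<^sup>2 > 1"
      by linarith
    then have c_neg: "poly [:1 - 16 * ?m\<^sup>2:] x < 0"
      by simp
    then show "poly [:1 - 16 * ?m\<^sup>2:] x \<le> 0"
      by simp
    assume "poly (BM_Q (Suc n)) x = 0"
    then have "poly [:0, 4:] x < 0"
      using zeros_BM_Q_neg by simp
    then show "poly [:0, 4:] x \<le> 0" "poly [:0, 4:] x + poly [:1 - 16 * ?m\<^sup>2:] x < 0"
      using c_neg by simp_all
  qed
  then show ?thesis
    by (simp add: Sturm_sequence_def)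
qed

end
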